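(* Let $P(k) = 112k^3-116k^2+35k-3$. Then $$\sum_{k=1}^\infty \frac{(-16)^{k} \big( P(k) H_{2k-1} -\frac{ (4k-1)(6k-1)(8k-3) }{4(2k-1)} \big)}{k^2(2k-1)(4k-1)(4k-3) \binom{3k}{k}\binom{6k}{3k}} = \frac{\pi^2}{2} \log 2 - \frac{7}{2} \zeta(3)$$ and $$\sum_{k=1}^\infty \frac{(-16)^{k} \big( P(k) (2H_{6k-1}-H_{3k-1}-3H_{k-1}) -64k^2+46k -17/2 \big)}{k^2(2k-1)(4k-1)(4k-3) \binom{3k}{k}\binom{6k}{3k}} = 7 \zeta(3) -2\pi^2 \log 2.$$
   Context: For $n\in\{0,1,2,\ldots\}$, $H_n=\sum_{0<j\le n}\frac1j$ denotes the usual harmonic number (so $H_0=0$). $\zeta$ is the Riemann zeta function and $\log$ is the natural logarithm. *)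

theory Defs
  imports "HOL-Analysis.Harmonic_Numbers"
begin

(* The Riemann zeta function on the real half-line s > 1, by its Dirichlet series
   1 + 1/2^s + 1/3^s + ...  For s \<le> 1 the series diverges and the value is meaningless
   (this is not the analytic continuation). *)
definition zeta :: "real \<Rightarrow> real" where
  "zeta s = (\<Sum>n. 1 / real (Suc n) powr s)"

definition P :: "real \<Rightarrow> real" where
  "P x = 112 * x ^ 3 - 116 * x ^ 2 + 35 * x - 3"

(* The common denominator.  The linear factors are taken in the reals, so no truncated
   subtraction occurs. *)
definition denom :: "nat \<Rightarrow> real" where
  "denom k = real k ^ 2 * (2 * real k - 1) * (4 * real k - 1) * (4 * real k - 3)
     * real ((3 * k) choose k) * real ((6 * k) choose (3 * k))"

(* The terms of the two series, meant for k \<ge> 1; there the natural-number subtractions in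
   the indices of the harmonic numbers are exact. *)
definition term1 :: "nat \<Rightarrow> real" where
  "term1 k = (- 16) ^ k
     * (P (real k) * harm (2 * k - 1)
        - (4 * real k - 1) * (6 * real k - 1) * (8 * real k - 3) / (4 * (2 * real k - 1)))
     / denom k"

definition term2 :: "nat \<Rightarrow> real" where
  "term2 k = (- 16) ^ k
     * (P (real k) * (2 * harm (6 * k - 1) - harm (3 * k - 1) - 3 * harm (k - 1))
        - 64 * real k ^ 2 + 46 * real k - 17 / 2)
     / denom k"

end

theory Submission
  imports Defs "HOL-Analysis.Analysis" "HOL-Real_Asymp.Real_Asymp"
begin

text \<open>
  Both series are accelerated forms of slowly convergent Euler sums over the half-integers
  x = m + 1/2. Put

      f n x = (-1)^n n!^2 / (x^2 (x^2 - 1^2) (x^2 - 2^2) ... (x^2 - n^2)),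

  so that f 0 x = 1/x^2. The point is that f (n + 1) x - f n x = g n (x + 1) - g n x for an explicit
  g, a rational multiple of f: the two functions form a WZ pair (wz_f_step). Let S n be the sum of
  f n x over x = 2n + 1/2, 2n + 3/2, ... . Passing from S n to S (n + 1) removes the first two terms,
  and the change of f on the remaining ones telescopes to a single value of g. As |f n x| is at most
  3^(-n) / x^2 on this range, S n tends to 0, and S 0 is the sum of all these differences
  (markov_acceleration). At x = 2n + 1/2 the product in f n runs over the consecutive half-integers
  n + 1/2, ..., 3n + 1/2, and this is what produces the two binomial coefficients (core_diagonal).

  The harmonic numbers enter by differentiation. The pair (f, g) is a member of a family of WZ pairs
  with further parameters, coming from Dougall's well-poised summation theorem, and the derivative
  of a WZ pair with respect to a parameter is again a WZ pair. Two such derivatives matter. They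
  multiply f by the weights H_m and O_(m-n) + O_(m+n+1) - H_n, where O_k = 1 + 1/3 + ... + 1/(2k-1),
  and they add rational corrections to g (wz_sigma, wz_tau). All that is verified here is that
  each correction telescopes correctly, which is a rational identity (wz_sigma_step, wz_tau_step).
  With the first weight, the difference S n - S (n + 1) is -2 times the (n+1)-st term of the first
  series; with the second weight it is minus the sum of the (n+1)-st term of the second series and
  twice that of the first (term1_accelerated, term2_accelerated).

  What remains is to evaluate the sums S 0, namely
      sum H_m / (m + 1/2)^2 = 7 zeta(3) - pi^2 log 2  and
      sum (O_m + O_(m+1)) / (m + 1/2)^2 = pi^2 log 2.
  In the manner of Euler, the double series of 1/(a b (a + b)) is summed along rows, columns and
  diagonals, once with a odd and b even and once with a and b both odd. Equating the results gives
  linear equations which determine both sums (euler_sums_odd_squares).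
\<close>

section \<open>Shifted sums and odd harmonic numbers\<close>

lemma difference_of_shift_sums:
  fixes f :: "nat \<Rightarrow> real"
  assumes "f \<longlonglongrightarrow> 0"
  shows "(\<lambda>j. f j - f (j + p)) sums (\<Sum>j<p. f j)"
proof -
  have partial: "(\<Sum>j<N. f j - f (j + p)) = (\<Sum>j<p. f j) - (\<Sum>j<p. f (j + N))" for N
  proof (induction N)
    case (Suc N)
    have "(\<Sum>j<p. f (j + Suc N)) = (\<Sum>j<p. f (j + N)) + f (N + p) - f N"
      using sum.lessThan_Suc[of "\<lambda>j. f (j + N)" p] sum.lessThan_Suc_shift[of "\<lambda>j. f (j + N)" p]
      by (simp add: add.commute)
    with Suc show ?case by simp
  qed simp
  have "(\<lambda>N. \<Sum>j<p. f (j + N)) \<longlonglongrightarrow> 0"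
    using LIMSEQ_ignore_initial_segment[OF assms] by (intro tendsto_null_sum) (simp add: add.commute)
  then show ?thesis
    unfolding sums_def partial using tendsto_diff[OF tendsto_const] by fastforce
qed

definition odd_harm :: "nat \<Rightarrow> real" where
  "odd_harm m = (\<Sum>j<m. 1 / (2 * real j + 1))"

lemma odd_harm_0 [simp]: "odd_harm 0 = 0"
  by (simp add: odd_harm_def)

lemma odd_harm_Suc: "odd_harm (Suc m) = odd_harm m + 1 / (2 * real m + 1)"
  by (simp add: odd_harm_def)

lemma harm_double: "harm (2 * m) = odd_harm m + harm m / 2"
  by (induction m) (simp_all add: odd_harm_Suc harm_Suc harm_def field_simps)

lemma odd_harm_nonneg: "odd_harm m \<ge> 0"
  by (simp add: odd_harm_def sum_nonneg)

text \<open>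
  The growth is logarithmic, but a power of m below 1 is all that convergence needs, and the
  square root has a short induction.
\<close>

lemma harm_le_sqrt: "harm m \<le> 2 * sqrt (real m)"
proof (induction m)
  case (Suc m)
  define s t where "s = sqrt (real m)" and "t = sqrt (real (Suc m))"
  have st: "0 \<le> s" "s \<le> t" "1 \<le> t" "t\<^sup>2 - s\<^sup>2 = 1"
    by (auto simp: s_def t_def)
  have "(t - s) * (t + s) = 1"
    using st by (simp add: algebra_simps power2_eq_square)
  moreover have "(t - s) * (t + s) \<le> (t - s) * (2 * t)"
    using st by (intro mult_left_mono) auto
  ultimately have "1 / t \<le> 2 * (t - s)"
    using st by (simp add: field_simps)
  moreover have "1 / t\<^sup>2 \<le> 1 / t"
    using st by (intro frac_le) (auto intro: self_le_power)
  moreover have "inverse (real (Suc m)) = 1 / t\<^sup>2"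
    by (simp add: t_def field_simps)
  ultimately have "inverse (real (Suc m)) \<le> 2 * (t - s)"
    by (metis order_trans)
  with Suc show ?case
    unfolding harm_Suc s_def t_def by simp
qed (simp add: harm_def)

lemma odd_harm_le_harm: "odd_harm m \<le> harm m"
  unfolding odd_harm_def harm_altdef by (intro sum_mono) (simp add: field_simps)

lemma summable_sqrt_div_square: "summable (\<lambda>m. sqrt (real m + 1/2) / (real m + 1/2)\<^sup>2)"
proof (rule summable_comparison_test')
  show "summable (\<lambda>m. real m powr (-3/2))" by (subst summable_real_powr_iff) simp
  fix m :: nat assume m: "m \<ge> 1"
  have x: "sqrt x / x\<^sup>2 = x powr (-3/2)" if "x > 0" for x :: real
    using that by (simp add: powr_half_sqrt [symmetric] powr_diff [symmetric] powr_realpow [symmetric]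
      del: powr_numeral)
  show "norm (sqrt (real m + 1/2) / (real m + 1/2)\<^sup>2) \<le> real m powr (-3/2)"
    using m by (subst x) (auto intro!: powr_mono2')
qed

section \<open>Double series with nonnegative terms\<close>

text \<open>
  For nonnegative terms, one convergent iterated sum makes the double series unconditionally
  summable. The three lemmas of this section pass from one order of summation to the others.
\<close>

lemma has_sum_if_rows_sum:
  fixes F :: "nat \<Rightarrow> nat \<Rightarrow> real"
  assumes "\<And>i j. F i j \<ge> 0" "\<And>i. F i sums r i" "r sums R"
  shows "(case_prod F has_sum R) UNIV"
proof -
  have rows: "((\<lambda>j. case_prod F (i, j)) has_sum r i) UNIV" for i
    using assms sums_nonneg_imp_has_sum by auto
  have "r i \<ge> 0" for i
    using assms(1) sums_le[OF _ sums_zero assms(2)] by blast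
  then have r: "(r has_sum R) UNIV"
    by (intro sums_nonneg_imp_has_sum assms)
  have "case_prod F summable_on (SIGMA i:UNIV. UNIV)"
    by (rule summable_on_SigmaI[where g = r]) (use rows r assms(1) in \<open>auto simp: summable_on_def\<close>)
  from has_sum_SigmaI[OF rows r this] show ?thesis by simp
qed

lemma columns_sum_if_has_sum:
  fixes F :: "nat \<Rightarrow> nat \<Rightarrow> real"
  assumes "\<And>i j. F i j \<ge> 0" "(case_prod F has_sum R) UNIV" "\<And>j. (\<lambda>i. F i j) sums c j"
  shows "c sums R"
proof -
  have "((\<lambda>(j, i). F i j) has_sum R) (SIGMA j:UNIV. UNIV)"
    using assms(2) has_sum_swap[where f = "case_prod F" and A = UNIV and B = UNIV and S = R] by simp
  from has_sum_Sigma'[OF this, of c] have "(c has_sum R) UNIV"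
    using sums_nonneg_imp_has_sum[OF assms(3) assms(1)] by simp
  then show ?thesis by (rule has_sum_imp_sums)
qed

lemma diagonals_sum_if_has_sum:
  fixes F :: "nat \<Rightarrow> nat \<Rightarrow> real"
  assumes "(case_prod F has_sum R) UNIV"
  shows "(\<lambda>n. \<Sum>i\<le>n. F i (n - i)) sums R"
proof -
  have "((\<lambda>(n, i). F i (n - i)) has_sum R) (SIGMA n:UNIV. {..n}) \<longleftrightarrow> (case_prod F has_sum R) UNIV"
    by (rule has_sum_reindex_bij_witness[of _ "\<lambda>(i, j). (i + j, i)" "\<lambda>(n, i). (i, n - i)"]) auto
  then have "((\<lambda>(n, i). F i (n - i)) has_sum R) (SIGMA n:UNIV. {..n})" using assms by simp
  from has_sum_Sigma'[OF this, of "\<lambda>n. \<Sum>i\<le>n. F i (n - i)"]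
  have "((\<lambda>n. \<Sum>i\<le>n. F i (n - i)) has_sum R) UNIV"
    by (simp add: has_sum_finite)
  then show ?thesis by (rule has_sum_imp_sums)
qed

section \<open>Two Euler sums over the odd squares\<close>

lemma zeta_nat_sums:
  assumes "s \<ge> 2"
  shows "(\<lambda>n. 1 / real (Suc n) ^ s) sums zeta (real s)"
proof -
  have "summable (\<lambda>n. 1 / real (Suc n) ^ s)"
    using summable_Suc_iff[of "\<lambda>n. inverse (real n ^ s)"] inverse_power_summable[of s, where 'a = real] assms
    by (simp add: inverse_eq_divide)
  then show ?thesis
    unfolding zeta_def by (simp add: powr_realpow summable_sums)
qed

lemma sums_even_indices:
  fixes f :: "nat \<Rightarrow> real"
  assumes "f sums s" "(\<lambda>m. f (2 * m + 1)) sums t"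
  shows "(\<lambda>m. f (2 * m)) sums (s - t)"
proof -
  have "(\<lambda>m. \<Sum>i\<in>{m * 2..<m * 2 + 2}. f i) sums s"
    by (rule sums_group[OF assms(1)]) simp
  moreover have "(\<Sum>i\<in>{m * 2..<m * 2 + 2}. f i) = f (2 * m) + f (2 * m + 1)" for m
  proof -
    have "{m * 2..<m * 2 + 2} = {2 * m, 2 * m + 1}" by auto
    then show ?thesis by simp
  qed
  ultimately have "(\<lambda>m. f (2 * m) + f (2 * m + 1)) sums s" by simp
  from sums_diff[OF this assms(2)] show ?thesis by simp
qed

lemma sum_inverse_odd_powers:
  assumes "s \<ge> 2"
  shows "(\<lambda>m. 1 / (2 * real m + 1) ^ s) sums ((1 - 1 / 2 ^ s) * zeta (real s))"
proof -
  have "(\<lambda>m. 1 / real (Suc (2 * m + 1)) ^ s) sums (1 / 2 ^ s * zeta (real s))"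
    using sums_mult[OF zeta_nat_sums[OF assms], of "1 / 2 ^ s"]
    by (simp add: power_mult_distrib [symmetric] algebra_simps)
  from sums_even_indices[OF zeta_nat_sums[OF assms] this] show ?thesis
    by (simp add: algebra_simps)
qed

lemma zeta_2: "zeta 2 = pi\<^sup>2 / 6"
proof -
  have "(\<lambda>n. 1 / real (Suc n) ^ 2) sums (pi\<^sup>2 / 6)"
    using inverse_squares_sums by (simp add: add.commute)
  from sums_unique2[OF zeta_nat_sums[of 2] this] show ?thesis by simp
qed

lemma partial_fraction_difference:
  fixes a b c :: real
  assumes "a > 0" "b > 0" "c = a + b"
  shows "1 / (a * b * c) = (1 / b - 1 / c) / a\<^sup>2"
proof -
  have "1 / b - 1 / c = a / (b * c)" using assms by (simp add: field_simps)
  then show ?thesis using assms by (simp add: power2_eq_square)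
qed

lemma partial_fraction_sum:
  fixes a b c :: real
  assumes "a > 0" "b > 0" "c = a + b"
  shows "1 / (a * b * c) = (1 / a + 1 / b) / c\<^sup>2"
proof -
  have "1 / a + 1 / b = c / (a * b)" using assms by (simp add: field_simps)
  then show ?thesis using assms by (simp add: power2_eq_square)
qed

lemma alternating_harmonic_pairs_sums:
  "(\<lambda>j. 1 / (2 * real j + 1) - 1 / (2 * real j + 2)) sums ln 2"
  using alternating_harmonic_series_sums' by (simp add: inverse_eq_divide add.commute)

text \<open>
  The next five lemmas sum 1/(a b (a + b)) in each order. Along a row or a column one of a, b is
  fixed, and partial fractions leave a difference of two reciprocals. If these have the same
  parity, it is the difference of a null sequence and its shift; otherwise the series for log 2
  accounts for the change of parity. Along a diagonal a + b is fixed and the sum is finite.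
\<close>

lemma row_odd_even:
  "(\<lambda>j. 1 / ((2 * real i + 1) * (2 * real j + 2) * (2 * real i + 2 * real j + 3)))
     sums ((odd_harm (Suc i) - ln 2) / (2 * real i + 1)\<^sup>2)"
proof -
  have "(\<lambda>j. 1 / (2 * real j + 1)) \<longlonglongrightarrow> 0" by real_asymp
  from sums_diff[OF difference_of_shift_sums[OF this, of "Suc i"] alternating_harmonic_pairs_sums]
  have "(\<lambda>j. 1 / (2 * real j + 2) - 1 / (2 * real i + 2 * real j + 3)) sums (odd_harm (Suc i) - ln 2)"
    by (simp add: odd_harm_def algebra_simps)
  from sums_divide[OF this, of "(2 * real i + 1)\<^sup>2"] show ?thesis
    by (subst partial_fraction_difference) auto
qed

lemma row_odd_odd:
  "(\<lambda>j. 1 / ((2 * real i + 1) * (2 * real j + 1) * (2 * real i + 2 * real j + 2)))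
     sums ((ln 2 + harm i / 2) / (2 * real i + 1)\<^sup>2)"
proof -
  have "(\<lambda>j. 1 / (2 * real j + 2)) \<longlonglongrightarrow> 0" by real_asymp
  from difference_of_shift_sums[OF this, of i]
  have "(\<lambda>j. 1 / (2 * real j + 2) - 1 / (2 * real (j + i) + 2)) sums (harm i / 2)"
    by (simp add: harm_altdef sum_divide_distrib inverse_eq_divide algebra_simps)
  from sums_add[OF alternating_harmonic_pairs_sums this]
  have "(\<lambda>j. 1 / (2 * real j + 1) - 1 / (2 * real i + 2 * real j + 2)) sums (ln 2 + harm i / 2)"
    by (simp add: algebra_simps)
  from sums_divide[OF this, of "(2 * real i + 1)\<^sup>2"] show ?thesis
    by (subst partial_fraction_difference) auto
qed

lemma column_odd_even:
  "(\<lambda>i. 1 / ((2 * real i + 1) * (2 * real j + 2) * (2 * real i + 2 * real j + 3)))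
     sums (odd_harm (Suc j) / (2 * real j + 2)\<^sup>2)"
proof -
  have "(\<lambda>j. 1 / (2 * real j + 1)) \<longlonglongrightarrow> 0" by real_asymp
  from difference_of_shift_sums[OF this, of "Suc j"]
  have "(\<lambda>i. 1 / (2 * real i + 1) - 1 / (2 * real i + 2 * real j + 3)) sums odd_harm (Suc j)"
    by (simp add: odd_harm_def algebra_simps)
  from sums_divide[OF this, of "(2 * real j + 2)\<^sup>2"] show ?thesis
    by (subst mult.commute [of "2 * real _ + 1"], subst partial_fraction_difference) auto
qed

lemma diagonal_odd_even:
  "(\<Sum>i\<le>n. 1 / ((2 * real i + 1) * (2 * real (n - i) + 2) * (2 * real i + 2 * real (n - i) + 3)))
     = (odd_harm (Suc n) + harm (Suc n) / 2) / (2 * real (Suc n) + 1)\<^sup>2"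
proof -
  have "(\<Sum>i\<le>n. 1 / ((2 * real i + 1) * (2 * real (n - i) + 2) * (2 * real i + 2 * real (n - i) + 3)))
     = (\<Sum>i\<le>n. 1 / (2 * real i + 1) + 1 / (2 * real (n - i) + 2)) / (2 * real (Suc n) + 1)\<^sup>2"
    unfolding sum_divide_distrib
    by (intro sum.cong refl, subst partial_fraction_sum) (auto simp: of_nat_diff)
  also have "(\<Sum>i\<le>n. 1 / (2 * real i + 1) + 1 / (2 * real (n - i) + 2)) = odd_harm (Suc n) + harm (Suc n) / 2"
    using sum.nat_diff_reindex[of "\<lambda>i. 1 / (2 * real i + 2)" "Suc n"]
    by (simp add: sum.distrib odd_harm_def harm_altdef lessThan_Suc_atMost sum_divide_distrib
        inverse_eq_divide algebra_simps)
  finally show ?thesis .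
qed

lemma diagonal_odd_odd:
  "(\<Sum>i\<le>n. 1 / ((2 * real i + 1) * (2 * real (n - i) + 1) * (2 * real i + 2 * real (n - i) + 2)))
     = 2 * odd_harm (Suc n) / (2 * real n + 2)\<^sup>2"
proof -
  have "(\<Sum>i\<le>n. 1 / ((2 * real i + 1) * (2 * real (n - i) + 1) * (2 * real i + 2 * real (n - i) + 2)))
     = (\<Sum>i\<le>n. 1 / (2 * real i + 1) + 1 / (2 * real (n - i) + 1)) / (2 * real n + 2)\<^sup>2"
    unfolding sum_divide_distrib
    by (intro sum.cong refl, subst partial_fraction_sum) (auto simp: of_nat_diff)
  also have "(\<Sum>i\<le>n. 1 / (2 * real i + 1) + 1 / (2 * real (n - i) + 1)) = 2 * odd_harm (Suc n)"
    using sum.nat_diff_reindex[of "\<lambda>i. 1 / (2 * real i + 1)" "Suc n"]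
    by (simp add: sum.distrib odd_harm_def lessThan_Suc_atMost)
  finally show ?thesis .
qed

lemma summable_weighted:
  assumes "\<And>m. \<bar>w m\<bar> \<le> c * sqrt (real m + 1/2)"
  shows "summable (\<lambda>m. w m / (2 * real m + 1)\<^sup>2)"
proof (rule summable_comparison_test')
  show "summable (\<lambda>m. c / 4 * (sqrt (real m + 1/2) / (real m + 1/2)\<^sup>2))"
    by (intro summable_mult summable_sqrt_div_square)
  fix m :: nat
  have "(2 * real m + 1)\<^sup>2 = 4 * (real m + 1/2)\<^sup>2"
    by (simp add: power2_eq_square algebra_simps)
  moreover have "\<bar>w m\<bar> / (4 * (real m + 1/2)\<^sup>2) \<le> c * sqrt (real m + 1/2) / (4 * (real m + 1/2)\<^sup>2)"
    by (intro divide_right_mono assms) simp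
  ultimately show "norm (w m / (2 * real m + 1)\<^sup>2) \<le> c / 4 * (sqrt (real m + 1/2) / (real m + 1/2)\<^sup>2)"
    by (simp add: abs_divide)
qed

lemma harm_le_sqrt_half: "harm m \<le> 2 * sqrt (real m + 1/2)"
  using harm_le_sqrt[of m] real_sqrt_le_mono[of "real m" "real m + 1/2"] by linarith

text \<open>
  Write X and Y for the sums of odd_harm m and harm m over (2m + 1)^2. The sum of
  odd_harm j / (2j)^2 over j >= 1 appears as the column sum of the odd-even double series and, up to
  a factor 2, as the diagonal sum of the odd-odd one. Together with the two row sums and the
  remaining diagonal sum this gives two independent equations for X and Y.
\<close>

theorem euler_sums_odd_squares:
  shows "(\<lambda>m. harm m / (2 * real m + 1)\<^sup>2) sums (7/4 * zeta 3 - pi\<^sup>2 / 4 * ln 2)"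
    and "(\<lambda>m. odd_harm m / (2 * real m + 1)\<^sup>2) sums (pi\<^sup>2 / 8 * ln 2 - 7/16 * zeta 3)"
proof -
  define l where "l = 7/8 * zeta 3"
  have l: "(\<lambda>m. 1 / (2 * real m + 1) ^ 3) sums l"
    using sum_inverse_odd_powers[of 3] by (simp add: l_def)
  have q: "(\<lambda>m. 1 / (2 * real m + 1)\<^sup>2) sums (pi\<^sup>2 / 8)"
    using sum_inverse_odd_powers[of 2] by (simp add: zeta_2)
  define X where "X = (\<Sum>m. odd_harm m / (2 * real m + 1)\<^sup>2)"
  define Y where "Y = (\<Sum>m. harm m / (2 * real m + 1)\<^sup>2)"
  have Y: "(\<lambda>m. harm m / (2 * real m + 1)\<^sup>2) sums Y"
    unfolding Y_def by (intro summable_sums summable_weighted[where c = 2])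
      (simp add: harm_nonneg harm_le_sqrt_half)
  have X: "(\<lambda>m. odd_harm m / (2 * real m + 1)\<^sup>2) sums X"
    unfolding X_def by (intro summable_sums summable_weighted[where c = 2])
      (use odd_harm_nonneg odd_harm_le_harm harm_le_sqrt_half order_trans in \<open>simp; blast\<close>)
  have oe: "((\<lambda>(i, j). 1 / ((2 * real i + 1) * (2 * real j + 2) * (2 * real i + 2 * real j + 3)))
      has_sum (X + l - ln 2 * (pi\<^sup>2 / 8))) UNIV"
  proof (rule has_sum_if_rows_sum[OF _ row_odd_even])
    show "(\<lambda>i. (odd_harm (Suc i) - ln 2) / (2 * real i + 1)\<^sup>2) sums (X + l - ln 2 * (pi\<^sup>2 / 8))"
      using sums_diff[OF sums_add[OF X l] sums_mult[OF q, of "ln 2"]]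
      by (simp add: odd_harm_Suc diff_divide_distrib add_divide_distrib power2_eq_square power3_eq_cube mult.assoc)
  qed simp
  have oo: "((\<lambda>(i, j). 1 / ((2 * real i + 1) * (2 * real j + 1) * (2 * real i + 2 * real j + 2)))
      has_sum (ln 2 * (pi\<^sup>2 / 8) + Y / 2)) UNIV"
  proof (rule has_sum_if_rows_sum[OF _ row_odd_odd])
    show "(\<lambda>i. (ln 2 + harm i / 2) / (2 * real i + 1)\<^sup>2) sums (ln 2 * (pi\<^sup>2 / 8) + Y / 2)"
      using sums_add[OF sums_mult[OF q, of "ln 2"] sums_divide[OF Y, of 2]]
      by (simp add: add_divide_distrib mult.commute)
  qed simp
  have "(\<lambda>j. odd_harm (Suc j) / (2 * real j + 2)\<^sup>2) sums (X + l - ln 2 * (pi\<^sup>2 / 8))"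
    by (rule columns_sum_if_has_sum[OF _ oe column_odd_even]) simp
  moreover have "(\<lambda>j. 2 * odd_harm (Suc j) / (2 * real j + 2)\<^sup>2) sums (ln 2 * (pi\<^sup>2 / 8) + Y / 2)"
    using diagonals_sum_if_has_sum[OF oo] unfolding diagonal_odd_odd .
  ultimately have 1: "2 * (X + l - ln 2 * (pi\<^sup>2 / 8)) = ln 2 * (pi\<^sup>2 / 8) + Y / 2"
    using sums_mult[of _ _ 2] sums_unique2 by fastforce
  have "(\<lambda>n. (odd_harm (Suc n) + harm (Suc n) / 2) / (2 * real (Suc n) + 1)\<^sup>2)
      sums (X + l - ln 2 * (pi\<^sup>2 / 8))"
    using diagonals_sum_if_has_sum[OF oe] unfolding diagonal_odd_even .
  then have "(\<lambda>n. (odd_harm n + harm n / 2) / (2 * real n + 1)\<^sup>2) sums (X + l - ln 2 * (pi\<^sup>2 / 8))"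
    by (subst (asm) sums_Suc_iff) (simp add: harm_def)
  moreover have "(\<lambda>n. (odd_harm n + harm n / 2) / (2 * real n + 1)\<^sup>2) sums (X + Y / 2)"
    using sums_add[OF X sums_divide[OF Y, of 2]] by (simp add: add_divide_distrib mult.commute)
  ultimately have 2: "X + l - ln 2 * (pi\<^sup>2 / 8) = X + Y / 2"
    by (rule sums_unique2)
  show "(\<lambda>m. harm m / (2 * real m + 1)\<^sup>2) sums (7/4 * zeta 3 - pi\<^sup>2 / 4 * ln 2)"
  proof -
    have "Y = 7/4 * zeta 3 - pi\<^sup>2 / 4 * ln 2"
      using 2 unfolding l_def by (simp add: algebra_simps)
    then show ?thesis using Y by simp
  qed
  have "X = pi\<^sup>2 / 8 * ln 2 - 7/16 * zeta 3"
  proof -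
    define c where "c = pi\<^sup>2 / 8 * ln 2"
    have "ln 2 * (pi\<^sup>2 / 8) = c" by (simp add: c_def)
    then show ?thesis using 1 2 unfolding l_def c_def [symmetric] by simp
  qed
  then show "(\<lambda>m. odd_harm m / (2 * real m + 1)\<^sup>2) sums (pi\<^sup>2 / 8 * ln 2 - 7/16 * zeta 3)"
    using X by simp
qed

section \<open>Acceleration of a series by a WZ pair\<close>

text \<open>
  The sum of F n over m >= 2n is compared with the sum of F (n + 1) over m >= 2n + 2. The
  differences on the common range telescope to a value of G, so that the summand on the left-hand
  side below is exactly the difference of the two sums. The range starts at 2n because the bound
  3^(-n), which makes these sums vanish in the limit, is only available there.
\<close>

lemma markov_acceleration:
  fixes F G :: "nat \<Rightarrow> nat \<Rightarrow> real"
  assumes step: "\<And>n m. m \<ge> 2 * n + 2 \<Longrightarrow> F (Suc n) m - F n m = G n (Suc m) - G n m"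
    and bound: "\<And>n m. m \<ge> 2 * n \<Longrightarrow> \<bar>F n m\<bar> \<le> b m / 3 ^ n"
    and summable: "summable b"
    and boundary: "\<And>n. G n \<longlonglongrightarrow> 0"
  shows "(\<lambda>n. F n (2 * n) + F n (2 * n + 1) + G n (2 * n + 2)) sums (\<Sum>m. F 0 m)"
proof -
  define S where "S n = (\<Sum>k. F n (k + 2 * n))" for n
  have b: "b m \<ge> 0" for m
    using order_trans[OF abs_ge_zero bound[of 0 m]] by simp
  have b_shift: "summable (\<lambda>k. b (k + j) / 3 ^ n)" for j n
    by (intro summable_divide summable_ignore_initial_segment summable)
  have F_summable: "summable (\<lambda>k. F n (k + 2 * n))" for n
    by (rule summable_comparison_test'[OF b_shift[of "2 * n" n]]) (simp add: bound)
  have "S n - S (Suc n) = F n (2 * n) + F n (2 * n + 1) + G n (2 * n + 2)" for n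
  proof -
    have "(\<lambda>k. G n (Suc k + (2 * n + 2)) - G n (k + (2 * n + 2))) sums (0 - G n (0 + (2 * n + 2)))"
      by (intro telescope_sums LIMSEQ_ignore_initial_segment boundary)
    moreover have "G n (Suc k + (2 * n + 2)) - G n (k + (2 * n + 2)) =
        F (Suc n) (k + 2 * Suc n) - F n (k + 2 + 2 * n)" for k
      using step[of n "k + 2 * n + 2"] by (simp add: algebra_simps)
    ultimately have "(\<lambda>k. F (Suc n) (k + 2 * Suc n) - F n (k + 2 + 2 * n)) sums (- G n (2 * n + 2))"
      by simp
    moreover have "(\<lambda>k. F (Suc n) (k + 2 * Suc n) - F n (k + 2 + 2 * n))
        sums (S (Suc n) - (S n - (\<Sum>k<2. F n (k + 2 * n))))"
      unfolding S_def
      by (intro sums_diff summable_sums F_summable sums_split_initial_segment)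
    ultimately have "S (Suc n) - (S n - (\<Sum>k<2. F n (k + 2 * n))) = - G n (2 * n + 2)"
      using sums_unique2 by blast
    then show ?thesis by (simp add: numeral_2_eq_2)
  qed
  moreover have "S \<longlonglongrightarrow> 0"
  proof (rule Lim_null_comparison)
    have "\<bar>S n\<bar> \<le> (\<Sum>m. b m) / 3 ^ n" for n
    proof -
      have "\<bar>S n\<bar> \<le> (\<Sum>k. b (k + 2 * n) / 3 ^ n)"
        unfolding S_def real_norm_def [symmetric]
        by (intro norm_suminf_le b_shift) (simp add: bound)
      also have "\<dots> = (\<Sum>k. b (k + 2 * n)) / 3 ^ n"
        by (intro suminf_divide summable_ignore_initial_segment summable)
      also have "\<dots> \<le> (\<Sum>m. b m) / 3 ^ n"
        using suminf_split_initial_segment[OF summable, of "2 * n"] b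
        by (intro divide_right_mono) (simp_all add: sum_nonneg)
      finally show ?thesis .
    qed
    then show "\<forall>\<^sub>F n in sequentially. norm (S n) \<le> (\<Sum>m. b m) / 3 ^ n" by simp
    show "(\<lambda>n. (\<Sum>m. b m) / 3 ^ n) \<longlonglongrightarrow> 0"
      using tendsto_mult_right_zero[OF LIMSEQ_power_zero[of "1/3 :: real"], of "\<Sum>m. b m"]
      by (simp add: power_divide)
  qed
  from telescope_sums'[OF this] have "(\<lambda>n. S n - S (Suc n)) sums S 0" by simp
  ultimately show ?thesis by (simp add: S_def)
qed

section \<open>The WZ pair and its corrections\<close>

text \<open>
  The product of x + i for -n <= i <= n, that is, x times the product of x^2 - j^2 for 1 <= j <= n.
\<close>

definition centred :: "nat \<Rightarrow> real \<Rightarrow> real" where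
  "centred n x = pochhammer (x - real n) (2 * n + 1)"

lemma centred_Suc: "centred (Suc n) x = (x - real n - 1) * (x + real n + 1) * centred n x"
proof -
  have "centred (Suc n) x = pochhammer (x - real n - 1) (Suc (Suc (2 * n + 1)))"
    by (simp add: centred_def algebra_simps)
  also have "\<dots> = (x - real n - 1) * pochhammer (x - real n) (Suc (2 * n + 1))"
    by (subst pochhammer_rec) simp
  also have "\<dots> = (x - real n - 1) * (x + real n + 1) * centred n x"
    by (subst pochhammer_Suc) (simp add: centred_def algebra_simps)
  finally show ?thesis .
qed

lemma centred_shift:
  assumes "x \<noteq> real n"
  shows "centred n (x + 1) = (x + real n + 1) * centred n x / (x - real n)"
proof -
  have "(x - real n) * centred n (x + 1) = pochhammer (x - real n) (Suc (2 * n + 1))"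
    by (subst pochhammer_rec) (simp add: centred_def algebra_simps)
  also have "\<dots> = (x + real n + 1) * centred n x"
    by (subst pochhammer_Suc) (simp add: centred_def algebra_simps)
  finally show ?thesis using assms by (simp add: field_simps)
qed

definition core :: "nat \<Rightarrow> real \<Rightarrow> real" where
  "core n x = (-1) ^ n * (fact n)\<^sup>2 / centred n x"

lemma core_Suc:
  "core (Suc n) x = - ((real n + 1)\<^sup>2 / ((x - real n - 1) * (x + real n + 1))) * core n x"
  by (simp add: core_def centred_Suc power2_eq_square mult_ac add.commute[of 1 "real n"])

lemma core_shift:
  assumes "x > real n"
  shows "core n (x + 1) = (x - real n) / (x + real n + 1) * core n x"
  using assms by (simp add: core_def centred_shift)

definition wz_f :: "nat \<Rightarrow> real \<Rightarrow> real" where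
  "wz_f n x = core n x / x"

text \<open>
  Found with Gosper's algorithm: the difference f (n + 1) - f n is a constant multiple of
  x / centred (n + 1) x, and the antidifference of this is a multiple of x - 1/2 over the product
  of all factors of centred (n + 1) x except the last.
\<close>

definition wz_g :: "nat \<Rightarrow> real \<Rightarrow> real" where
  "wz_g n x = core n x * (x - 1/2) / ((2 * real n + 1) * (x - real n - 1))"

text \<open>
  The correction for the weight H_m. Shifting m changes the weight by 1 / (x + 1/2), which
  cancels the factor x + 1/2 of g n (x + 1); the rest is the reciprocal of a product of 2n + 2
  consecutive factors, and so it telescopes.
\<close>

definition wz_sigma :: "nat \<Rightarrow> real \<Rightarrow> real" where
  "wz_sigma n x = core n x / (2 * real n + 1)\<^sup>2"

text \<open>
  The correction for the weight pair_weight defined below. The double pole at x = n + 1 is that of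
  the right-hand side of wz_tau_step; the numerator is then found by comparing coefficients.
\<close>

definition wz_tau :: "nat \<Rightarrow> real \<Rightarrow> real" where
  "wz_tau n x = core n x * (x - 1/2) * (x - 2 * real n - 3/2)
     / ((2 * real n + 1)\<^sup>2 * (x - real n - 1)\<^sup>2)"

lemma wz_g_shift:
  assumes "x > real n"
  shows "wz_g n (x + 1) = core n x * (x + 1/2) / ((2 * real n + 1) * (x + real n + 1))"
proof -
  have "x + 1 - real n - 1 = x - real n" "x + 1 - 1/2 = x + 1/2" by simp_all
  then show ?thesis
    using assms by (simp only: wz_g_def core_shift) simp
qed

lemma wz_f_step:
  assumes "x > real n + 1"
  shows "wz_f (Suc n) x - wz_f n x = wz_g n (x + 1) - wz_g n x"
proof -
  define N K where "N = real n" and "K = core n x"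
  have nz: "x \<noteq> 0" "x - N - 1 \<noteq> 0" "x + N + 1 \<noteq> 0" "2 * N + 1 \<noteq> 0"
    using assms by (auto simp: N_def)
  have "- ((N + 1)\<^sup>2 / ((x - N - 1) * (x + N + 1))) * K / x - K / x =
     K * (x + 1/2) / ((2 * N + 1) * (x + N + 1)) - K * (x - 1/2) / ((2 * N + 1) * (x - N - 1))"
    using nz by (simp add: divide_simps) algebra
  then show ?thesis
    using assms by (simp add: wz_f_def wz_g_shift core_Suc N_def K_def) (simp add: wz_g_def)
qed

lemma wz_sigma_step:
  assumes "x > real n"
  shows "wz_sigma n (x + 1) - wz_sigma n x = - wz_g n (x + 1) / (x + 1/2)"
proof -
  define N K where "N = real n" and "K = core n x"
  have nz: "x + N + 1 \<noteq> 0" "2 * N + 1 \<noteq> 0" "x + 1/2 \<noteq> 0"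
    using assms by (auto simp: N_def)
  have "(x - N) / (x + N + 1) * K / (2 * N + 1)\<^sup>2 - K / (2 * N + 1)\<^sup>2 = - (K / ((2 * N + 1) * (x + N + 1)))"
    using nz(1,2) by (simp add: divide_simps) algebra
  also have "\<dots> = - (K * (x + 1/2) / ((2 * N + 1) * (x + N + 1))) / (x + 1/2)"
    using nz(3) by simp
  finally show ?thesis
    using assms by (simp add: wz_sigma_def wz_g_shift core_shift N_def K_def)
qed

lemma wz_tau_step:
  assumes "x > real n + 1"
  shows "wz_tau n (x + 1) - wz_tau n x =
    - wz_f (Suc n) x * (x\<^sup>2 / ((real n + 1) * (x - real n - 1) * (x + real n + 1)))
    - wz_g n (x + 1) * ((x + 1/2) / ((x - real n) * (x + real n + 1)))"
proof -
  define N K where "N = real n" and "K = core n x"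
  have nz: "x \<noteq> 0" "x - N \<noteq> 0" "x - N - 1 \<noteq> 0" "x + N + 1 \<noteq> 0" "2 * N + 1 \<noteq> 0" "N + 1 \<noteq> 0"
    using assms by (auto simp: N_def)
  have "x + 1 - N - 1 = x - N" "x + 1 - 1/2 = x + 1/2" "x + 1 - 2 * N - 3/2 = x - 2 * N - 1/2"
    by simp_all
  then have tau: "wz_tau n (x + 1) = K * (x + 1/2) * (x - 2 * N - 1/2) / ((2 * N + 1)\<^sup>2 * (x - N) * (x + N + 1))"
    using assms nz core_shift[of n x] by (simp only: wz_tau_def K_def N_def) (simp add: power2_eq_square mult_ac)
  have "K * (x + 1/2) * (x - 2 * N - 1/2) / ((2 * N + 1)\<^sup>2 * (x - N) * (x + N + 1)) -
      K * (x - 1/2) * (x - 2 * N - 3/2) / ((2 * N + 1)\<^sup>2 * (x - N - 1)\<^sup>2) =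
     (N + 1)\<^sup>2 / ((x - N - 1) * (x + N + 1)) * K / x * (x\<^sup>2 / ((N + 1) * (x - N - 1) * (x + N + 1))) -
     K * (x + 1/2) / ((2 * N + 1) * (x + N + 1)) * ((x + 1/2) / ((x - N) * (x + N + 1)))"
    using nz by (simp add: divide_simps) algebra
  then show ?thesis
    using assms unfolding tau by (simp add: wz_tau_def wz_f_def wz_g_shift core_Suc N_def K_def)
qed

section \<open>Weights and bounds\<close>

text \<open>
  For x >= 2(n + 1) one has x^2 - (n + 1)^2 >= 3 (n + 1)^2, so each step in n gains a factor 1/3.
\<close>

lemma core_bound:
  assumes "x \<ge> 2 * real n" "x > 0"
  shows "\<bar>core n x\<bar> \<le> 1 / (x * 3 ^ n)"
  using assms(1)
proof (induction n)
  case 0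
  with assms(2) show ?case by (simp add: core_def centred_def)
next
  case (Suc n)
  define N where "N = real n + 1"
  have N: "x \<ge> 2 * N" "N \<ge> 1" using Suc.prems by (auto simp: N_def)
  have "2 * N * (2 * N) \<le> x * x" using N by (intro mult_mono) auto
  then have le: "3 * N\<^sup>2 \<le> (x - N) * (x + N)" by (simp add: power2_eq_square algebra_simps)
  have pos: "0 < N\<^sup>2" using N by simp
  with le have apos: "0 < (x - N) * (x + N)" by linarith
  then have "N\<^sup>2 / ((x - N) * (x + N)) \<le> 1 / 3"
    using le by (simp add: pos_divide_le_eq)
  then have "N\<^sup>2 / ((x - N) * (x + N)) * \<bar>core n x\<bar> \<le> 1 / 3 * (1 / (x * 3 ^ n))"
    using Suc by (intro mult_mono) auto
  moreover have "\<bar>core (Suc n) x\<bar> = N\<^sup>2 / ((x - N) * (x + N)) * \<bar>core n x\<bar>"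
  proof -
    have "core (Suc n) x = - (N\<^sup>2 / ((x - N) * (x + N))) * core n x"
      by (simp add: core_Suc N_def diff_diff_eq add.assoc)
    then show ?thesis using apos by (simp only: abs_mult abs_minus_cancel) (simp add: abs_of_pos)
  qed
  ultimately show ?case by (simp add: mult_ac)
qed

lemma wz_f_bound:
  assumes "x \<ge> 2 * real n" "x > 0"
  shows "\<bar>wz_f n x\<bar> \<le> 1 / (x\<^sup>2 * 3 ^ n)"
  using divide_right_mono[OF core_bound[OF assms], of x] assms
  by (simp add: wz_f_def abs_divide power2_eq_square mult_ac)

lemma core_bound':
  assumes "x \<ge> 2 * real n" "x > 0"
  shows "\<bar>core n x\<bar> \<le> 1 / x"
proof -
  have "1 / (x * 3 ^ n) \<le> 1 / (x * 1)"
    using assms by (intro divide_left_mono mult_left_mono) auto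
  with core_bound[OF assms] show ?thesis by simp
qed

lemma wz_g_bound:
  assumes "x \<ge> 2 * real n + 2"
  shows "\<bar>wz_g n x\<bar> \<le> 2 / x"
proof -
  have "\<bar>(x - 1/2) / ((2 * real n + 1) * (x - real n - 1))\<bar> = (x - 1/2) / ((2 * real n + 1) * (x - real n - 1))"
    using assms by simp
  also have "\<dots> \<le> x / (1 * (x / 2))"
    using assms by (intro frac_le mult_mono) auto
  also have "\<dots> = 2" using assms by simp
  finally have "\<bar>core n x\<bar> * \<bar>(x - 1/2) / ((2 * real n + 1) * (x - real n - 1))\<bar> \<le> 1 / x * 2"
    using assms core_bound'[of n x] by (intro mult_mono) auto
  then show ?thesis by (simp add: wz_g_def abs_mult abs_divide)
qed

lemma wz_sigma_bound:
  assumes "x \<ge> 2 * real n + 2"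
  shows "\<bar>wz_sigma n x\<bar> \<le> 1 / x"
proof -
  have "\<bar>core n x\<bar> / (2 * real n + 1)\<^sup>2 \<le> 1 / x / 1"
    using assms core_bound'[of n x] by (intro frac_le) auto
  then show ?thesis by (simp add: wz_sigma_def abs_divide)
qed

lemma wz_tau_bound:
  assumes "x \<ge> 2 * real n + 2"
  shows "\<bar>wz_tau n x\<bar> \<le> 4 / x"
proof -
  define r where "r = (x - 2 * real n - 3/2) / ((2 * real n + 1) * (x - real n - 1))"
  have "r \<ge> 0" using assms by (simp add: r_def)
  have "r \<le> x / (1 * (x / 2))"
    unfolding r_def using assms by (intro frac_le mult_mono) auto
  also have "\<dots> = 2" using assms by simp
  finally have "\<bar>r\<bar> \<le> 2" using \<open>r \<ge> 0\<close> by simp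
  then have "\<bar>wz_g n x\<bar> * \<bar>r\<bar> \<le> 2 / x * 2"
    using assms wz_g_bound[of n x] by (intro mult_mono) auto
  moreover have "wz_tau n x = wz_g n x * r"
    by (simp add: wz_tau_def wz_g_def r_def power2_eq_square mult_ac)
  ultimately show ?thesis by (simp add: abs_mult)
qed

text \<open>
  With w(m + 1/2) = odd_harm m, which satisfies w(x + 1) = w(x) + 1/(2x), the first two summands are
  w(x - n) + w(x + n + 1) at x = m + 1/2. This is, up to a constant, the logarithmic derivative of
  the ratio of Gamma functions Gamma(x - n + c) / Gamma(x + n + 1 - c) at c = 0, halved; the
  ratio itself, at c = 0, is the reciprocal of centred n x.
\<close>

definition pair_weight :: "nat \<Rightarrow> nat \<Rightarrow> real" where
  "pair_weight n m = odd_harm (m - n) + odd_harm (m + n + 1) - harm n"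

lemma pair_weight_Suc_left:
  assumes "m > n"
  defines "x \<equiv> real m + 1/2"
  shows "pair_weight (Suc n) m = pair_weight n m - x\<^sup>2 / ((real n + 1) * (x - real n - 1) * (x + real n + 1))"
proof -
  obtain d where m: "m = n + Suc d" using assms(1) less_imp_Suc_add by auto
  define N D where "N = real n" and "D = real d"
  have nn: "N \<ge> 0" "D \<ge> 0" by (auto simp: N_def D_def)
  have x: "x = N + D + 3/2" by (simp add: x_def m N_def D_def)
  have "pair_weight (Suc n) m = pair_weight n m - 1 / (2 * D + 1) + 1 / (2 * (2 * N + D + 2) + 1) - 1 / (N + 1)"
    by (simp add: pair_weight_def m odd_harm_Suc harm_Suc inverse_eq_divide N_def D_def add_ac)
  moreover have "x\<^sup>2 / ((N + 1) * (x - N - 1) * (x + N + 1)) =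
      1 / (2 * D + 1) - 1 / (2 * (2 * N + D + 2) + 1) + 1 / (N + 1)"
  proof -
    define u v where "u = 2 * D + 1" and "v = 4 * N + 2 * D + 5"
    have "u \<noteq> 0" "v \<noteq> 0" "v - u \<noteq> 0" using nn by (auto simp: u_def v_def)
    then have "((u + v) / 4)\<^sup>2 / ((v - u) / 4 * (u / 2) * (v / 2)) = 1 / u - 1 / v + 1 / ((v - u) / 4)"
      by (simp add: divide_simps) algebra
    moreover have x': "x = (u + v) / 4"
      and "N + 1 = (v - u) / 4" "x - N - 1 = u / 2" "x + N + 1 = v / 2" "2 * (2 * N + D + 2) + 1 = v"
      by (auto simp: x u_def v_def)
    ultimately show ?thesis unfolding u_def [symmetric] by (simp only:)
  qed
  ultimately show ?thesis unfolding N_def by linarith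
qed

lemma pair_weight_Suc_right:
  assumes "m \<ge> n"
  defines "x \<equiv> real m + 1/2"
  shows "pair_weight n (Suc m) = pair_weight n m + (x + 1/2) / ((x - real n) * (x + real n + 1))"
proof -
  obtain d where m: "m = n + d" using assms(1) le_Suc_ex by auto
  define N D where "N = real n" and "D = real d"
  have nn: "N \<ge> 0" "D \<ge> 0" by (auto simp: N_def D_def)
  have x: "x = N + D + 1/2" by (simp add: x_def m N_def D_def)
  have "Suc m - n = Suc d" "m - n = d" using m by auto
  then have "pair_weight n (Suc m) = pair_weight n m + 1 / (2 * D + 1) + 1 / (2 * (2 * N + D + 1) + 1)"
    by (simp add: pair_weight_def m odd_harm_Suc N_def D_def add_ac)
  moreover have "(x + 1/2) / ((x - N) * (x + N + 1)) = 1 / (2 * D + 1) + 1 / (2 * (2 * N + D + 1) + 1)"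
  proof -
    define u v where "u = 2 * D + 1" and "v = 4 * N + 2 * D + 3"
    have "u \<noteq> 0" "v \<noteq> 0" using nn by (auto simp: u_def v_def)
    then have "(u + v) / 4 / (u / 2 * (v / 2)) = 1 / u + 1 / v"
      by (simp add: divide_simps)
    moreover have "x + 1/2 = (u + v) / 4" "x - N = u / 2" "x + N + 1 = v / 2"
      "2 * (2 * N + D + 1) + 1 = v"
      by (auto simp: x u_def v_def)
    ultimately show ?thesis unfolding u_def [symmetric] by (simp only:)
  qed
  ultimately show ?thesis unfolding N_def by linarith
qed

lemma pair_weight_bound:
  assumes "m \<ge> 2 * n"
  shows "\<bar>pair_weight n m\<bar> \<le> 8 * sqrt (real m + 1/2)"
proof -
  define s where "s = sqrt (real m + 1/2)"
  have "odd_harm (m - n) \<le> 2 * s"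
  proof -
    have "odd_harm (m - n) \<le> 2 * sqrt (real (m - n))"
      using odd_harm_le_harm harm_le_sqrt order_trans by blast
    also have "\<dots> \<le> 2 * s" unfolding s_def by (intro mult_left_mono real_sqrt_le_mono) auto
    finally show ?thesis .
  qed
  moreover have "odd_harm (m + n + 1) \<le> 4 * s"
  proof -
    have "odd_harm (m + n + 1) \<le> 2 * sqrt (real (m + n + 1))"
      using odd_harm_le_harm harm_le_sqrt order_trans by blast
    \<comment> \<open>Crude, but 4 is a square and m + n + 1 is at most 3m/2 + 1.\<close>
    also have "\<dots> \<le> 2 * sqrt (4 * (real m + 1/2))"
      using assms by (intro mult_left_mono real_sqrt_le_mono) auto
    also have "\<dots> = 4 * s" unfolding s_def by (subst real_sqrt_mult) simp
    finally show ?thesis .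
  qed
  moreover have "harm n \<le> 2 * s"
  proof -
    have "harm n \<le> 2 * sqrt (real n)" by (rule harm_le_sqrt)
    also have "\<dots> \<le> 2 * s" unfolding s_def using assms by (intro mult_left_mono real_sqrt_le_mono) auto
    finally show ?thesis .
  qed
  moreover have "0 \<le> odd_harm (m - n)" "0 \<le> odd_harm (m + n + 1)" "0 \<le> (harm n :: real)" "0 \<le> s"
    by (auto simp: odd_harm_nonneg harm_nonneg s_def)
  ultimately show ?thesis unfolding pair_weight_def s_def [symmetric] by linarith
qed

text \<open>
  If F = f w and G = g w + t, the product rule for differences splits the WZ equation of (F, G) into
  that of (f, g), multiplied by w, and the equation required of t below.
\<close>

lemma weighted_acceleration:
  fixes w t :: "nat \<Rightarrow> nat \<Rightarrow> real"
  defines "F \<equiv> \<lambda>n m. wz_f n (real m + 1/2) * w n m"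
    and "G \<equiv> \<lambda>n m. wz_g n (real m + 1/2) * w n m + t n m"
  assumes weight: "\<And>n m. m \<ge> 2 * n \<Longrightarrow> \<bar>w n m\<bar> \<le> 8 * sqrt (real m + 1/2)"
    and correction: "\<And>n m. m \<ge> 2 * n + 2 \<Longrightarrow> \<bar>t n m\<bar> \<le> 4 / (real m + 1/2)"
    and step: "\<And>n m. m \<ge> 2 * n + 2 \<Longrightarrow> t n (Suc m) - t n m =
        wz_f (Suc n) (real m + 1/2) * (w (Suc n) m - w n m)
      - wz_g n (real m + 3/2) * (w n (Suc m) - w n m)"
  shows "(\<lambda>n. F n (2 * n) + F n (2 * n + 1) + G n (2 * n + 2)) sums (\<Sum>m. w 0 m / (real m + 1/2)\<^sup>2)"
proof -
  have "(\<lambda>n. F n (2 * n) + F n (2 * n + 1) + G n (2 * n + 2)) sums (\<Sum>m. F 0 m)"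
  proof (rule markov_acceleration)
    fix n m :: nat assume m: "m \<ge> 2 * n + 2"
    define x where "x = real m + 1/2"
    have x: "real (Suc m) + 1/2 = x + 1" "real m + 3/2 = x + 1" by (auto simp: x_def)
    have "x > real n + 1" using m by (simp add: x_def)
    from wz_f_step[OF this] step[OF m] show "F (Suc n) m - F n m = G n (Suc m) - G n m"
      unfolding F_def G_def x x_def [symmetric] by algebra
  next
    fix n m :: nat assume m: "m \<ge> 2 * n"
    define x where "x = real m + 1/2"
    have "\<bar>F n m\<bar> \<le> 1 / (x\<^sup>2 * 3 ^ n) * (8 * sqrt x)"
      unfolding F_def abs_mult x_def using m
      by (intro mult_mono wz_f_bound weight) auto
    then show "\<bar>F n m\<bar> \<le> 8 * (sqrt (real m + 1/2) / (real m + 1/2)\<^sup>2) / 3 ^ n"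
      by (simp add: x_def mult_ac)
  next
    show "summable (\<lambda>m. 8 * (sqrt (real m + 1/2) / (real m + 1/2)\<^sup>2))"
      by (intro summable_mult summable_sqrt_div_square)
  next
    fix n
    show "G n \<longlonglongrightarrow> 0"
    proof (rule Lim_null_comparison)
      show "\<forall>\<^sub>F m in sequentially. norm (G n m) \<le>
          2 / (real m + 1/2) * (8 * sqrt (real m + 1/2)) + 4 / (real m + 1/2)"
        using eventually_ge_at_top[of "2 * n + 2"]
      proof eventually_elim
        case (elim m)
        define x where "x = real m + 1/2"
        have "\<bar>wz_g n x * w n m\<bar> \<le> 2 / x * (8 * sqrt x)"
          unfolding abs_mult x_def using elim by (intro mult_mono wz_g_bound weight) auto
        with correction[OF elim] show ?case
          unfolding G_def x_def real_norm_def by linarith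
      qed
      show "(\<lambda>m. 2 / (real m + 1/2) * (8 * sqrt (real m + 1/2)) + 4 / (real m + 1/2)) \<longlonglongrightarrow> 0"
        by real_asymp
    qed
  qed
  then show ?thesis
    by (simp add: F_def wz_f_def core_def centred_def power2_eq_square)
qed

section \<open>The accelerated terms in closed form\<close>

lemma binomial_product_pochhammer:
  "real ((3 * k) choose k) * real ((6 * k) choose (3 * k)) =
     16 ^ k * pochhammer (1/2) (3 * k) / (pochhammer (1/2) k * (fact k)\<^sup>2)"
proof -
  have "real ((3 * k) choose k) = fact (3 * k) / (fact k * fact (2 * k))"
    using binomial_fact[of k "3 * k", where 'a = real] by simp
  moreover have "real ((6 * k) choose (3 * k)) = fact (6 * k) / (fact (3 * k) * fact (3 * k))"
    using binomial_fact[of "3 * k" "6 * k", where 'a = real] by simp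
  moreover have "(fact (2 * k) :: real) = 4 ^ k * pochhammer (1/2) k * fact k"
    using fact_double[of k, where 'a = real] by (simp add: power_mult)
  moreover have "(fact (6 * k) :: real) = 64 ^ k * pochhammer (1/2) (3 * k) * fact (3 * k)"
    using fact_double[of "3 * k", where 'a = real] by (simp add: power_mult)
  moreover have "(64 :: real) ^ k = 16 ^ k * 4 ^ k"
    by (simp flip: power_mult_distrib)
  ultimately show ?thesis by (simp add: power2_eq_square)
qed

text \<open>
  With k = n + 1, the rising factorial (1/2)_(3k) factors into (1/2)_n, the product of the
  half-integers from n + 1/2 to 3n + 1/2, which is the denominator of core at 2n + 1/2, and two
  further factors.
\<close>

lemma core_diagonal:
  "(-16) ^ Suc n / (real ((3 * Suc n) choose Suc n) * real ((6 * Suc n) choose (3 * Suc n))) =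
     - (2 * (real n + 1)\<^sup>2 * core n (2 * real n + 1/2) / (3 * (6 * real n + 5)))"
proof -
  define p :: "nat \<Rightarrow> real" where "p = pochhammer (1/2)"
  define c where "c = centred n (2 * real n + 1/2)"
  have c: "c = pochhammer (1/2 + real n) (2 * n + 1)"
    by (simp add: c_def centred_def add.commute)
  have nz: "p n \<noteq> 0" "c \<noteq> 0"
    by (simp_all add: p_def c pochhammer_pos less_imp_neq[THEN not_sym])
  have p1: "p (Suc n) = p n * (2 * real n + 1) / 2"
    by (simp add: p_def pochhammer_Suc add.commute field_simps)
  have "p (3 * n + 1) = p n * c"
    using pochhammer_product'[of "1/2 :: real" n "2 * n + 1"] by (simp add: p_def c)
  moreover have "3 * Suc n = Suc (Suc (3 * n + 1))" by simp
  then have "p (3 * Suc n) = p (3 * n + 1) * (1/2 + real (3 * n + 1)) * (1/2 + real (Suc (3 * n + 1)))"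
    by (simp only: p_def pochhammer_Suc)
  moreover have "1/2 + real (3 * n + 1) = (6 * real n + 3) / 2"
    "1/2 + real (Suc (3 * n + 1)) = (6 * real n + 5) / 2" by simp_all
  ultimately have p3: "p (3 * Suc n) = p n * c * ((6 * real n + 3) / 2) * ((6 * real n + 5) / 2)"
    by (simp only:)
  have "(-16 :: real) ^ Suc n = (-1) ^ Suc n * 16 ^ Suc n"
    by (simp flip: power_mult_distrib)
  then have "(-16) ^ Suc n / (real ((3 * Suc n) choose Suc n) * real ((6 * Suc n) choose (3 * Suc n))) =
      (-1) ^ Suc n * (p (Suc n) * (fact (Suc n))\<^sup>2 / p (3 * Suc n))"
    unfolding binomial_product_pochhammer p_def [symmetric] by simp
  also have "\<dots> = (-1) ^ Suc n * (fact (Suc n))\<^sup>2 / c * ((2 * real n + 1) / 2 / ((6 * real n + 3) / 2 * ((6 * real n + 5) / 2)))"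
  proof -
    have "s * (p n * a / 2 * F / (p n * c * u * v)) = s * F / c * (a / 2 / (u * v))" for s a F u v
      using nz by (simp add: mult_ac)
    then show ?thesis unfolding p1 p3 by this
  qed
  also have "(2 * real n + 1) / 2 / ((6 * real n + 3) / 2 * ((6 * real n + 5) / 2)) = 2 / (3 * (6 * real n + 5))"
  proof -
    have r: "u / 2 / (3 * u / 2 * (v / 2)) = 2 / (3 * v)" if "u \<noteq> 0" for u v :: real
      using that by simp
    have eq: "6 * real n + 3 = 3 * (2 * real n + 1)" by simp
    show ?thesis unfolding eq by (rule r) (simp add: add_eq_0_iff)
  qed
  finally show ?thesis
    unfolding core_def c_def [symmetric]
    by (simp add: power_mult_distrib mult_ac add.commute[of 1 "real n"])
qed

lemma diagonal_values:
  fixes n :: nat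
  defines "N \<equiv> real n" and "K \<equiv> core n (2 * real n + 1/2)"
  shows "wz_f n (2 * N + 1/2) = 2 * K / (4 * N + 1)"
    and "wz_f n (2 * N + 3/2) = 2 * K / (3 * (4 * N + 3))"
    and "wz_g n (2 * N + 5/2) = 4 * (N + 1) * K / (3 * (6 * N + 5) * (2 * N + 1))"
    and "wz_sigma n (2 * N + 5/2) = (2 * N + 3) * K / (3 * (6 * N + 5) * (2 * N + 1)\<^sup>2)"
    and "wz_tau n (2 * N + 5/2) = 8 * (N + 1) * K / (3 * (6 * N + 5) * (2 * N + 1)\<^sup>2 * (2 * N + 3))"
proof -
  have N: "N \<ge> 0" by (simp add: N_def)
  have "core n (2 * N + 1/2 + 1) = (2 * N + 1/2 - N) / (2 * N + 1/2 + N + 1) * K"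
    unfolding K_def N_def by (rule core_shift) simp
  also have "(2 * N + 1/2 - N) / (2 * N + 1/2 + N + 1) = 1 / 3"
    using N by (simp add: field_simps)
  finally have "core n (2 * N + 1/2 + 1) = K / 3" by simp
  moreover have "2 * N + 1/2 + 1 = 2 * N + 3/2" by simp
  ultimately have k1: "core n (2 * N + 3/2) = K / 3" by (simp only:)
  have "core n (2 * N + 3/2 + 1) = (2 * N + 3/2 - N) / (2 * N + 3/2 + N + 1) * core n (2 * N + 3/2)"
    unfolding N_def by (rule core_shift) simp
  also have "(2 * N + 3/2 - N) / (2 * N + 3/2 + N + 1) = (2 * N + 3) / (6 * N + 5)"
    using N by (simp add: field_simps)
  finally have "core n (2 * N + 3/2 + 1) = (2 * N + 3) * K / (3 * (6 * N + 5))"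
    by (simp add: k1)
  moreover have "2 * N + 3/2 + 1 = 2 * N + 5/2" by simp
  ultimately have k2: "core n (2 * N + 5/2) = (2 * N + 3) * K / (3 * (6 * N + 5))" by (simp only:)
  show "wz_f n (2 * N + 1/2) = 2 * K / (4 * N + 1)"
    using N by (simp add: wz_f_def K_def N_def divide_simps)
  show "wz_f n (2 * N + 3/2) = 2 * K / (3 * (4 * N + 3))"
    unfolding wz_f_def k1 using N by (simp add: field_simps)
  have g_denom: "2 * N + 5/2 - N - 1 = (2 * N + 3) / 2" by (simp add: field_simps)
  show g: "wz_g n (2 * N + 5/2) = 4 * (N + 1) * K / (3 * (6 * N + 5) * (2 * N + 1))"
  proof -
    have "w * K / (3 * v) * (2 * m) / (u * (w / 2)) = 4 * m * K / (3 * v * u)" if "w \<noteq> 0" for m u v w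
      using that by (simp add: mult_ac)
    moreover have "2 * N + 5/2 - 1/2 = 2 * (N + 1)" "2 * N + 3 \<noteq> 0" using N by auto
    ultimately show ?thesis unfolding wz_g_def N_def [symmetric] k2 g_denom by (simp only:) simp
  qed
  show "wz_sigma n (2 * N + 5/2) = (2 * N + 3) * K / (3 * (6 * N + 5) * (2 * N + 1)\<^sup>2)"
    unfolding wz_sigma_def N_def [symmetric] k2 by simp
  have "wz_tau n (2 * N + 5/2) = wz_g n (2 * N + 5/2) * (2 / ((2 * N + 1) * (2 * N + 3)))"
    unfolding wz_tau_def wz_g_def N_def [symmetric] g_denom by (simp add: power2_eq_square mult_ac)
  then show "wz_tau n (2 * N + 5/2) = 8 * (N + 1) * K / (3 * (6 * N + 5) * (2 * N + 1)\<^sup>2 * (2 * N + 3))"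
    unfolding g by (simp add: power2_eq_square mult_ac)
qed

lemma summand_core:
  fixes n :: nat
  defines "N \<equiv> real n"
  shows "(-16) ^ Suc n * X / denom (Suc n) =
    - (2 * core n (2 * N + 1/2) * X / (3 * (6 * N + 5) * (2 * N + 1) * (4 * N + 3) * (4 * N + 1)))"
proof -
  have "(-16) ^ Suc n * X / denom (Suc n) =
     ((-16) ^ Suc n / (real ((3 * Suc n) choose Suc n) * real ((6 * Suc n) choose (3 * Suc n)))) *
     (X / ((N + 1)\<^sup>2 * (2 * N + 1) * (4 * N + 3) * (4 * N + 1)))"
    by (simp add: denom_def N_def mult_ac add_ac)
  moreover have "N + 1 \<noteq> 0" by (simp add: N_def add_eq_0_iff)
  ultimately show ?thesis unfolding core_diagonal N_def [symmetric] by (simp add: mult_ac)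
qed

lemma term1_accelerated:
  "term1 (Suc n) = - 1/2 *
    (wz_f n (2 * real n + 1/2) * harm (2 * n) + wz_f n (2 * real n + 3/2) * harm (2 * n + 1)
     + (wz_g n (2 * real n + 5/2) * harm (2 * n + 2) + wz_sigma n (2 * real n + 5/2)))"
proof -
  define N K H where "N = real n" and "K = core n (2 * real n + 1/2)" and "H = (harm (2 * n + 1) :: real)"
  have nz: "2 * N + 1 \<noteq> 0" "4 * N + 1 \<noteq> 0" "4 * N + 3 \<noteq> 0" "6 * N + 5 \<noteq> 0" "N + 1 \<noteq> 0"
    by (simp_all add: N_def add_eq_0_iff)
  \<comment> \<open>Everything is expressed through the one harmonic number that occurs in the series.\<close>
  have h: "harm (2 * n) = H - 1 / (2 * N + 1)" "harm (2 * n + 2) = H + 1 / (2 * (N + 1))"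
    by (simp_all add: H_def harm_Suc N_def inverse_eq_divide add_ac)
  have idx: "2 * Suc n - 1 = 2 * n + 1" "real (Suc n) = N + 1" by (simp_all add: N_def)
  have "term1 (Suc n) = - (2 * K * (P (N + 1) * H - (4 * (N + 1) - 1) * (6 * (N + 1) - 1) * (8 * (N + 1) - 3)
       / (4 * (2 * (N + 1) - 1))) / (3 * (6 * N + 5) * (2 * N + 1) * (4 * N + 3) * (4 * N + 1)))"
    unfolding term1_def summand_core idx H_def N_def K_def by simp
  also have "4 * (2 * (N + 1) - 1) = 4 * (2 * N + 1)" by simp
  also have "- (2 * K * (P (N + 1) * H - (4 * (N + 1) - 1) * (6 * (N + 1) - 1) * (8 * (N + 1) - 3)
       / (4 * (2 * N + 1))) / (3 * (6 * N + 5) * (2 * N + 1) * (4 * N + 3) * (4 * N + 1))) =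
     - 1/2 * (2 * K / (4 * N + 1) * (H - 1 / (2 * N + 1)) + 2 * K / (3 * (4 * N + 3)) * H
       + (4 * (N + 1) * K / (3 * (6 * N + 5) * (2 * N + 1)) * (H + 1 / (2 * (N + 1)))
          + (2 * N + 3) * K / (3 * (6 * N + 5) * (2 * N + 1)\<^sup>2)))"
    unfolding P_def using nz by (simp add: divide_simps) algebra
  finally show ?thesis
    unfolding diagonal_values h by (simp add: N_def K_def H_def)
qed

text \<open>
  By H_(2j) = O_j + H_j / 2, the left-hand side is 2 O_(3n+3) - 3 H_n and 2 H_(2n+1) is
  2 O_(n+1) + H_n. This is how the harmonic numbers of the second series turn into the weight.
\<close>

lemma harm_combination:
  "2 * harm (6 * n + 5) - harm (3 * n + 2) - 3 * harm n =
    2 * (odd_harm (n + 1) + odd_harm (3 * n + 3) - harm n) - 2 * harm (2 * n + 1)"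
proof -
  define a where "a = 1 / (real n + 1)"
  have idx: "6 * n + 6 = Suc (6 * n + 5)" "3 * n + 3 = Suc (3 * n + 2)" "2 * n + 2 = Suc (2 * n + 1)"
    "n + 1 = Suc n" by simp_all
  have h: "harm (6 * n + 6) = harm (6 * n + 5) + a / 6"
    "harm (3 * n + 3) = harm (3 * n + 2) + a / 3"
    "harm (2 * n + 2) = harm (2 * n + 1) + a / 2" "harm (n + 1) = harm n + a"
    unfolding idx harm_Suc inverse_eq_divide by (simp_all add: a_def field_simps)
  have "harm (6 * n + 6) = odd_harm (3 * n + 3) + harm (3 * n + 3) / 2"
    "harm (2 * n + 2) = odd_harm (n + 1) + harm (n + 1) / 2"
    using harm_double[of "3 * n + 3"] harm_double[of "n + 1"] by (simp_all add: algebra_simps)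
  then have *: "harm (6 * n + 5) + a / 6 = odd_harm (3 * n + 3) + (harm (3 * n + 2) + a / 3) / 2"
    "harm (2 * n + 1) + a / 2 = odd_harm (n + 1) + (harm n + a) / 2"
    unfolding h .
  have "2 * h6 - h3 - 3 * h0 = 2 * (o1 + o3 - h0) - 2 * h2"
    if "h6 + a / 6 = o3 + (h3 + a / 3) / 2" "h2 + a / 2 = o1 + (h0 + a) / 2" for h0 h2 h3 h6 o1 o3
    using that by (simp add: field_simps)
  from this[OF *] show ?thesis .
qed

text \<open>
  Adding twice the first series removes H_(2n+1), which pair_weight cannot produce.
\<close>

lemma term2_accelerated:
  "term2 (Suc n) + 2 * term1 (Suc n) = -
    (wz_f n (2 * real n + 1/2) * pair_weight n (2 * n) + wz_f n (2 * real n + 3/2) * pair_weight n (2 * n + 1)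
     + (wz_g n (2 * real n + 5/2) * pair_weight n (2 * n + 2) + wz_tau n (2 * real n + 5/2)))"
proof -
  define N K M where "N = real n" and "K = core n (2 * real n + 1/2)"
    and "M = odd_harm (n + 1) + odd_harm (3 * n + 3) - harm n"
  have nz: "2 * N + 1 \<noteq> 0" "4 * N + 1 \<noteq> 0" "4 * N + 3 \<noteq> 0" "6 * N + 5 \<noteq> 0" "N + 1 \<noteq> 0" "2 * N + 3 \<noteq> 0"
    by (simp_all add: N_def add_eq_0_iff)
  have w: "pair_weight n (2 * n) = M - 1 / (2 * N + 1) - 1 / (3 * (2 * N + 1)) - 1 / (6 * N + 5)"
    "pair_weight n (2 * n + 1) = M - 1 / (6 * N + 5)"
    "pair_weight n (2 * n + 2) = M + 1 / (2 * N + 3)"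
  proof -
    have o: "odd_harm (n + 1) = odd_harm n + 1 / (2 * N + 1)"
      "odd_harm (n + 2) = odd_harm (n + 1) + 1 / (2 * N + 3)"
      "odd_harm (3 * n + 2) = odd_harm (3 * n + 1) + 1 / (3 * (2 * N + 1))"
      "odd_harm (3 * n + 3) = odd_harm (3 * n + 2) + 1 / (6 * N + 5)"
      using odd_harm_Suc[of n] odd_harm_Suc[of "n + 1"] odd_harm_Suc[of "3 * n + 1"] odd_harm_Suc[of "3 * n + 2"]
      by (simp_all add: N_def numeral_eq_Suc algebra_simps)
    have i: "2 * n - n = n" "2 * n + n + 1 = 3 * n + 1" "2 * n + 1 - n = n + 1" "2 * n + 1 + n + 1 = 3 * n + 2"
      "2 * n + 2 - n = n + 2" "2 * n + 2 + n + 1 = 3 * n + 3" by simp_all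
    show "pair_weight n (2 * n) = M - 1 / (2 * N + 1) - 1 / (3 * (2 * N + 1)) - 1 / (6 * N + 5)"
      "pair_weight n (2 * n + 1) = M - 1 / (6 * N + 5)"
      "pair_weight n (2 * n + 2) = M + 1 / (2 * N + 3)"
      unfolding pair_weight_def i M_def using o by linarith+
  qed
  define H where "H = (harm (2 * n + 1) :: real)"
  have h: "2 * harm (6 * n + 5) - harm (3 * n + 2) - 3 * harm n = 2 * M - 2 * H"
    using harm_combination[of n] unfolding M_def H_def .
  have idx: "6 * Suc n - 1 = 6 * n + 5" "3 * Suc n - 1 = 3 * n + 2" "Suc n - 1 = n" "2 * Suc n - 1 = 2 * n + 1"
    "real (Suc n) = N + 1" by (simp_all add: N_def)
  have "term2 (Suc n) + 2 * term1 (Suc n) =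
    - (2 * K * (P (N + 1) * (2 * M - 2 * H) - 64 * (N + 1)\<^sup>2 + 46 * (N + 1) - 17/2)
       / (3 * (6 * N + 5) * (2 * N + 1) * (4 * N + 3) * (4 * N + 1)))
    + 2 * (- (2 * K * (P (N + 1) * H - (4 * (N + 1) - 1) * (6 * (N + 1) - 1) * (8 * (N + 1) - 3)
       / (4 * (2 * (N + 1) - 1))) / (3 * (6 * N + 5) * (2 * N + 1) * (4 * N + 3) * (4 * N + 1))))"
    unfolding term1_def term2_def summand_core idx h unfolding H_def N_def K_def by simp
  also have "4 * (2 * (N + 1) - 1) = 4 * (2 * N + 1)" by simp
  also have "- (2 * K * (P (N + 1) * (2 * M - 2 * H) - 64 * (N + 1)\<^sup>2 + 46 * (N + 1) - 17/2)
       / (3 * (6 * N + 5) * (2 * N + 1) * (4 * N + 3) * (4 * N + 1)))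
    + 2 * (- (2 * K * (P (N + 1) * H - (4 * (N + 1) - 1) * (6 * (N + 1) - 1) * (8 * (N + 1) - 3)
       / (4 * (2 * N + 1))) / (3 * (6 * N + 5) * (2 * N + 1) * (4 * N + 3) * (4 * N + 1)))) =
    - (2 * K / (4 * N + 1) * (M - 1 / (2 * N + 1) - 1 / (3 * (2 * N + 1)) - 1 / (6 * N + 5))
       + 2 * K / (3 * (4 * N + 3)) * (M - 1 / (6 * N + 5))
       + (4 * (N + 1) * K / (3 * (6 * N + 5) * (2 * N + 1)) * (M + 1 / (2 * N + 3))
          + 8 * (N + 1) * K / (3 * (6 * N + 5) * (2 * N + 1)\<^sup>2 * (2 * N + 3))))"
    unfolding P_def using nz by (simp add: divide_simps) algebra
  finally show ?thesis
    unfolding diagonal_values w by (simp add: N_def K_def)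
qed

theorem theorem1p12:
  shows "(\<lambda>n. term1 (Suc n)) sums (pi ^ 2 / 2 * ln 2 - 7 / 2 * zeta 3)
    \<and> (\<lambda>n. term2 (Suc n)) sums (7 * zeta 3 - 2 * pi ^ 2 * ln 2)"
proof -
  define A where "A n = wz_f n (2 * real n + 1/2) * harm (2 * n) + wz_f n (2 * real n + 3/2) * harm (2 * n + 1)
     + (wz_g n (2 * real n + 5/2) * harm (2 * n + 2) + wz_sigma n (2 * real n + 5/2))" for n
  define C where "C n = wz_f n (2 * real n + 1/2) * pair_weight n (2 * n)
     + wz_f n (2 * real n + 3/2) * pair_weight n (2 * n + 1)
     + (wz_g n (2 * real n + 5/2) * pair_weight n (2 * n + 2) + wz_tau n (2 * real n + 5/2))" for n
  have quarter: "a / (real m + 1/2)\<^sup>2 = 4 * (a / (2 * real m + 1)\<^sup>2)" for a m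
  proof -
    have "(2 * real m + 1)\<^sup>2 = 4 * (real m + 1/2)\<^sup>2" by (simp add: power2_eq_square algebra_simps)
    then show ?thesis by simp
  qed
  have arg: "real (2 * n) + 1/2 = 2 * real n + 1/2" "real (2 * n + 1) + 1/2 = 2 * real n + 3/2"
    "real (2 * n + 2) + 1/2 = 2 * real n + 5/2" for n by simp_all
  have "A sums (\<Sum>m. harm m / (real m + 1/2)\<^sup>2)"
  proof -
    have "(\<lambda>n. wz_f n (real (2 * n) + 1/2) * harm (2 * n) + wz_f n (real (2 * n + 1) + 1/2) * harm (2 * n + 1)
      + (wz_g n (real (2 * n + 2) + 1/2) * harm (2 * n + 2) + wz_sigma n (real (2 * n + 2) + 1/2)))
      sums (\<Sum>m. harm m / (real m + 1/2)\<^sup>2)"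
    proof (rule weighted_acceleration[where w = "\<lambda>n. harm" and t = "\<lambda>n m. wz_sigma n (real m + 1/2)"])
      fix n m :: nat
      show "\<bar>harm m :: real\<bar> \<le> 8 * sqrt (real m + 1/2)"
        using harm_le_sqrt_half[of m] harm_nonneg[of m, where 'a = real] by (simp add: abs_of_nonneg)
      assume m: "m \<ge> 2 * n + 2"
      then have "\<bar>wz_sigma n (real m + 1/2)\<bar> \<le> 1 / (real m + 1/2)"
        by (intro wz_sigma_bound) auto
      also have "\<dots> \<le> 4 / (real m + 1/2)" by (simp add: divide_right_mono)
      finally show "\<bar>wz_sigma n (real m + 1/2)\<bar> \<le> 4 / (real m + 1/2)" .
      have "wz_sigma n (real m + 1/2 + 1) - wz_sigma n (real m + 1/2) =
          - wz_g n (real m + 1/2 + 1) / (real m + 1/2 + 1/2)"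
        using m by (intro wz_sigma_step) auto
      moreover have "real (Suc m) + 1/2 = real m + 3/2" "real m + 1/2 + 1 = real m + 3/2" by simp_all
      ultimately show "wz_sigma n (real (Suc m) + 1/2) - wz_sigma n (real m + 1/2) =
          wz_f (Suc n) (real m + 1/2) * (harm m - harm m) - wz_g n (real m + 3/2) * (harm (Suc m) - harm m)"
        by (simp only:) (simp add: harm_Suc inverse_eq_divide add.commute)
    qed
    then show ?thesis unfolding A_def arg by simp
  qed
  moreover have "(\<Sum>m. harm m / (real m + 1/2)\<^sup>2) = 7 * zeta 3 - pi\<^sup>2 * ln 2"
    using sums_unique[OF sums_mult[OF euler_sums_odd_squares(1), of 4]] by (simp add: quarter algebra_simps)
  ultimately have A: "A sums (7 * zeta 3 - pi\<^sup>2 * ln 2)" by simp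
  have "C sums (\<Sum>m. pair_weight 0 m / (real m + 1/2)\<^sup>2)"
  proof -
    have "(\<lambda>n. wz_f n (real (2 * n) + 1/2) * pair_weight n (2 * n)
      + wz_f n (real (2 * n + 1) + 1/2) * pair_weight n (2 * n + 1)
      + (wz_g n (real (2 * n + 2) + 1/2) * pair_weight n (2 * n + 2) + wz_tau n (real (2 * n + 2) + 1/2)))
      sums (\<Sum>m. pair_weight 0 m / (real m + 1/2)\<^sup>2)"
    proof (rule weighted_acceleration[where t = "\<lambda>n m. wz_tau n (real m + 1/2)"])
      fix n m :: nat
      show "\<bar>pair_weight n m\<bar> \<le> 8 * sqrt (real m + 1/2)" if "m \<ge> 2 * n"
        using that by (rule pair_weight_bound)
      assume m: "m \<ge> 2 * n + 2"
      then show "\<bar>wz_tau n (real m + 1/2)\<bar> \<le> 4 / (real m + 1/2)"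
        by (intro wz_tau_bound) auto
      have "pair_weight (Suc n) m - pair_weight n m = - ((real m + 1/2)\<^sup>2 /
          ((real n + 1) * (real m + 1/2 - real n - 1) * (real m + 1/2 + real n + 1)))"
        using m by (subst pair_weight_Suc_left) auto
      moreover have "pair_weight n (Suc m) - pair_weight n m = (real m + 1/2 + 1/2) /
          ((real m + 1/2 - real n) * (real m + 1/2 + real n + 1))"
        using m by (subst pair_weight_Suc_right) auto
      moreover have "real (Suc m) + 1/2 = real m + 1/2 + 1" "real m + 3/2 = real m + 1/2 + 1" by simp_all
      moreover have "real m + 1/2 > real n + 1" using m by simp
      note wz_tau_step[OF this]
      ultimately show "wz_tau n (real (Suc m) + 1/2) - wz_tau n (real m + 1/2) =
          wz_f (Suc n) (real m + 1/2) * (pair_weight (Suc n) m - pair_weight n m)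
          - wz_g n (real m + 3/2) * (pair_weight n (Suc m) - pair_weight n m)"
        by (simp only: mult_minus_left mult_minus_right)
    qed
    then show ?thesis unfolding C_def arg by simp
  qed
  moreover have "(\<Sum>m. pair_weight 0 m / (real m + 1/2)\<^sup>2) = pi\<^sup>2 * ln 2"
  proof -
    have "(\<lambda>m. 1 / (2 * real m + 1) ^ 3) sums (7/8 * zeta 3)"
      using sum_inverse_odd_powers[of 3] by simp
    from sums_mult[OF sums_add[OF sums_mult[OF euler_sums_odd_squares(2), of 2] this], of 4]
    have "(\<lambda>m. 4 * (2 * (odd_harm m / (2 * real m + 1)\<^sup>2) + 1 / (2 * real m + 1) ^ 3)) sums (pi\<^sup>2 * ln 2)"
      by (simp add: algebra_simps)
    moreover have "4 * (2 * (odd_harm m / (2 * real m + 1)\<^sup>2) + 1 / (2 * real m + 1) ^ 3) =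
        pair_weight 0 m / (real m + 1/2)\<^sup>2" for m
      \<comment> \<open>At n = 0 the weight is O_m + O_(m+1) = 2 O_m + 1 / (2m + 1).\<close>
      unfolding quarter
      by (simp add: pair_weight_def odd_harm_Suc harm_def add_divide_distrib power2_eq_square power3_eq_cube mult.assoc)
    ultimately show ?thesis by (simp add: sums_iff)
  qed
  ultimately have C: "C sums (pi\<^sup>2 * ln 2)" by simp
  have t1: "term1 (Suc n) = - 1/2 * A n" for n
    unfolding A_def by (rule term1_accelerated)
  have t2: "term2 (Suc n) = A n - C n" for n
    using term2_accelerated[of n] t1[of n] unfolding C_def by linarith
  show ?thesis
  proof
    show "(\<lambda>n. term1 (Suc n)) sums (pi ^ 2 / 2 * ln 2 - 7 / 2 * zeta 3)"
      using sums_mult[OF A, of "- 1/2"] unfolding t1 by (simp add: algebra_simps)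
    show "(\<lambda>n. term2 (Suc n)) sums (7 * zeta 3 - 2 * pi ^ 2 * ln 2)"
      using sums_diff[OF A C] unfolding t2 by (simp add: algebra_simps)
  qed
qed

end
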